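(* Let $\varepsilon\in(0,1)$. Under the condition $$\kappa\le d\le\eta\log n\quad\text{and}\quad p_{\max}\le n^{-1+\eta},$$ with high probability, for any $k\in[n^{1-\varepsilon}]$, $$D_k^{\downarrow}\le(1+\varepsilon)L_k.$$
   Context: Setting: $G$ is a random undirected graph on the vertex set $\{1,\dots,n\}$ (loops allowed) in which each edge $\{i,j\}$ (including $i=j$) is present with probability $p_{ij}=p_{ji}\in[0,1]$, independently of the others; $A$ is its adjacency matrix. Set $p_{\max}=\max_{i\ne j}p_{ij}$, $d_i=\sum_j p_{ij}$, $d=\max_i d_i$. The degree of $i$ is $D_i=\sum_j A_{ij}$, and $D_1^{\downarrow}\ge\dots\ge D_n^{\downarrow}$ are the degrees in decreasing order. For $x>0$, $[x]=\{1,2,\dots,\lfloor x\rfloor\}$. For $k\in[n]$, $$L_k=\frac{\log(n/k)}{\log((\log n)/d)}.$$ Parameters: $\kappa>0$ and $\eta\in(0,1)$. An admissible error function is a function $\psi(n,\kappa,\eta)$ such that for every $\kappa>0$, $\psi(n,\kappa,\eta)\to0$ as $n\to\infty$ and $\eta\to0$ (joint limit). "Under a condition $\mathcal A$ on the parameters $\kappa,\eta,(p_{ij})$, an event $E$ holds with high probability" means: there is an admissible error function $\psi$ with $\mathbb P(E)\ge1-\psi(n,\kappa,\eta)$ for all $n,\kappa,\eta,(p_{ij})_{i,j\in[n]}$ satisfying $\mathcal A$ ($\psi$ may depend on $\varepsilon$, but not on $(p_{ij})$). Here the event is that the inequality holds simultaneously for all $k\in[n^{1-\varepsilon}]$. 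*)

theory Defs
  imports "HOL-Probability.Probability"
begin

definition edge_probs :: "nat \<Rightarrow> (nat \<Rightarrow> nat \<Rightarrow> real) \<Rightarrow> bool" where
  "edge_probs n p \<longleftrightarrow>
     (\<forall>i\<in>{1..n}. \<forall>j\<in>{1..n}. p i j = p j i \<and> 0 \<le> p i j \<and> p i j \<le> 1)"

text \<open>The law of the adjacency matrix. There is one independent coin per unordered pair
  (loops included), represented by the ordered pair with first component at most the second.\<close>

definition adjacency_pmf :: "nat \<Rightarrow> (nat \<Rightarrow> nat \<Rightarrow> real) \<Rightarrow> (nat \<Rightarrow> nat \<Rightarrow> nat) pmf" where
  "adjacency_pmf n p =
     map_pmf (\<lambda>\<omega> i j. if \<omega> (min i j, max i j) then 1 else 0)
       (Pi_pmf {(i, j). 1 \<le> i \<and> i \<le> j \<and> j \<le> n} False (\<lambda>(i, j). bernoulli_pmf (p i j)))"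

text \<open>The element 0 is inserted only to give the maximum the value 0 when n = 1, where there
  are no off-diagonal entries; it changes nothing otherwise, as the entries are nonnegative.\<close>

definition p_max :: "nat \<Rightarrow> (nat \<Rightarrow> nat \<Rightarrow> real) \<Rightarrow> real" where
  "p_max n p = Max (insert 0 {p i j | i j. i \<in> {1..n} \<and> j \<in> {1..n} \<and> i \<noteq> j})"

definition mean_degree :: "nat \<Rightarrow> (nat \<Rightarrow> nat \<Rightarrow> real) \<Rightarrow> nat \<Rightarrow> real" where
  "mean_degree n p i = (\<Sum>j=1..n. p i j)"

definition max_mean_degree :: "nat \<Rightarrow> (nat \<Rightarrow> nat \<Rightarrow> real) \<Rightarrow> real" where
  "max_mean_degree n p = Max (mean_degree n p ` {1..n})"

definition vertex_degree :: "nat \<Rightarrow> (nat \<Rightarrow> nat \<Rightarrow> nat) \<Rightarrow> nat \<Rightarrow> nat" where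
  "vertex_degree n A i = (\<Sum>j=1..n. A i j)"

text \<open>The k-th largest degree, for k in {1..n}; list positions start at 0.\<close>

definition decreasing_degree :: "nat \<Rightarrow> (nat \<Rightarrow> nat \<Rightarrow> nat) \<Rightarrow> nat \<Rightarrow> nat" where
  "decreasing_degree n A k = rev (sort (map (vertex_degree n A) [1..<Suc n])) ! (k - 1)"

definition L_seq :: "nat \<Rightarrow> real \<Rightarrow> nat \<Rightarrow> real" where
  "L_seq n d k = ln (real n / real k) / ln (ln (real n) / d)"

definition upto_real :: "real \<Rightarrow> nat set" where
  "upto_real x = {1..nat \<lfloor>x\<rfloor>}"

definition admissible_error :: "(nat \<Rightarrow> real \<Rightarrow> real \<Rightarrow> real) \<Rightarrow> bool" where
  "admissible_error \<psi> \<longleftrightarrow>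
     (\<forall>\<kappa>>0. ((\<lambda>(n, \<eta>). \<psi> n \<kappa> \<eta>) \<longlongrightarrow> 0) (sequentially \<times>\<^sub>F at_right 0))"

text \<open>The condition takes the arguments n, kappa, eta and the edge probabilities; the event is
  a family of sets of adjacency matrices. The error function is uniform in the edge
  probabilities.\<close>

definition holds_whp_under ::
  "(nat \<Rightarrow> real \<Rightarrow> real \<Rightarrow> (nat \<Rightarrow> nat \<Rightarrow> real) \<Rightarrow> bool) \<Rightarrow>
   (nat \<Rightarrow> (nat \<Rightarrow> nat \<Rightarrow> real) \<Rightarrow> (nat \<Rightarrow> nat \<Rightarrow> nat) set) \<Rightarrow> bool" where
  "holds_whp_under cond E \<longleftrightarrow>
     (\<exists>\<psi>. admissible_error \<psi> \<and>
        (\<forall>n \<kappa> \<eta> p. n \<ge> 1 \<and> \<kappa> > 0 \<and> 0 < \<eta> \<and> \<eta> < 1 \<and> edge_probs n p \<and> cond n \<kappa> \<eta> p \<longrightarrow>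
           measure_pmf.prob (adjacency_pmf n p) (E n p) \<ge> 1 - \<psi> n \<kappa> \<eta>))"

end

theory Submission
  imports Defs
begin

text \<open>Chernoff bound for all ranks at once. Put \<open>t = ln (ln n / d)\<close>, \<open>\<delta> = \<epsilon> / (2 + \<epsilon>)\<close> and
  \<open>Y = (\<Sum>i. exp ((1 - \<delta>) t D\<^sub>i))\<close>. Since \<open>(1 + \<epsilon>) (1 - \<delta>) = 1 + \<delta>\<close>, if the k-th largest degree exceeds
  \<open>(1 + \<epsilon>) ln (n / k) / t\<close>, then k vertices contribute at least \<open>(n / k) powr (1 + \<delta>)\<close> each, so
  \<open>Y \<ge> n (n / k) powr \<delta> \<ge> n powr (1 + \<epsilon> \<delta>)\<close> for every \<open>k \<le> n powr (1 - \<epsilon>)\<close>. On the other hand, the mean of Y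
  is at most \<open>n exp (d exp ((1 - \<delta>) t)) = n exp (ln n (d / ln n) powr \<delta>)\<close>, which is at most
  \<open>n powr (1 + \<eta> powr \<delta>)\<close>, and Markov's inequality concludes.\<close>

text \<open>The first \<open>k\<close> positions of the decreasing list, \<open>0\<close> to
  \<open>k - 1\<close>, each contribute at least the value of \<open>g\<close> at position
  \<open>k - 1\<close>; the other terms are nonnegative.\<close>

lemma sum_list_ge_mult_decreasing_nth:
  fixes g :: "nat \<Rightarrow> real"
  assumes "1 \<le> k" "k \<le> length xs" "mono g" "\<And>x. 0 \<le> g x"
  shows "real k * g (rev (sort xs) ! (k - 1)) \<le> (\<Sum>x\<leftarrow>xs. g x)"
proof -
  define ys where "ys = rev (sort xs)"
  have len: "length ys = length xs" by (simp add: ys_def)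
  \<comment> \<open>Such a sum depends only on the multiset of entries, which sorting and reversing
    preserve.\<close>
  have "(\<Sum>x\<leftarrow>xs. g x) = (\<Sum>x\<leftarrow>ys. g x)"
    unfolding sum_mset_sum_list[symmetric] mset_map by (simp add: ys_def)
  also have "\<dots> = (\<Sum>j<length xs. g (ys ! j))"
    by (simp add: sum_list_sum_nth len atLeast0LessThan)
  finally have sum: "(\<Sum>x\<leftarrow>xs. g x) = (\<Sum>j<length xs. g (ys ! j))" .
  have "real k * g (ys ! (k - 1)) = (\<Sum>j<k. g (ys ! (k - 1)))" by simp
  also have "\<dots> \<le> (\<Sum>j<k. g (ys ! j))"
    using assms len by (intro sum_mono monoD[OF \<open>mono g\<close>] sorted_rev_nth_mono) (auto simp: ys_def)
  also have "\<dots> \<le> (\<Sum>j<length xs. g (ys ! j))"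
    using assms by (intro sum_mono2) auto
  finally show ?thesis by (simp add: sum ys_def)
qed

lemma mult_decreasing_degree_le_sum:
  fixes g :: "nat \<Rightarrow> real"
  assumes "1 \<le> k" "k \<le> n" "mono g" "\<And>x. 0 \<le> g x"
  shows "real k * g (decreasing_degree n A k) \<le> (\<Sum>i=1..n. g (vertex_degree n A i))"
  using sum_list_ge_mult_decreasing_nth[of k "map (vertex_degree n A) [1..<Suc n]" g] assms
  by (simp add: decreasing_degree_def interv_sum_list_conv_sum_set_nat atLeastLessThanSuc_atLeastAtMost o_def del: upt_Suc)

lemma finite_edges: "finite {(i, j). 1 \<le> i \<and> i \<le> j \<and> j \<le> (n::nat)}"
  by (rule finite_subset[of _ "{1..n} \<times> {1..n}"]) auto

text \<open>A single degree is a sum of independent Bernoulli variables, so its moment generating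
  function factorizes; each factor is then bounded by \<open>1 + x \<le> exp x\<close>.\<close>

lemma expectation_exp_vertex_degree_le:
  assumes p: "edge_probs n p" and i: "i \<in> {1..n}"
  shows "measure_pmf.expectation (adjacency_pmf n p) (\<lambda>A. exp (s * real (vertex_degree n A i)))
    \<le> exp (mean_degree n p i * (exp s - 1))"
proof -
  define E where "E = {(i, j). 1 \<le> i \<and> i \<le> j \<and> j \<le> n}"
  \<comment> \<open>\<open>e j\<close> is the coin that decides entry \<open>(i, j)\<close>. The
    weight \<open>f\<close> is constantly 1 on coins not touching vertex \<open>i\<close>, so the
    product can run over all of \<open>E\<close>, the index set of the product law.\<close>
  define e where "e j = (min i j, max i j)" for j
  define f where "f a b = (if a \<in> e ` {1..n} \<and> b then exp s else 1)" for a b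
  have fin: "finite E" unfolding E_def by (rule finite_edges)
  have inj: "inj_on e {1..n}"
    by (rule inj_onI) (auto simp: e_def min_def max_def split: if_splits)
  have sub: "e ` {1..n} \<subseteq> E" using i by (auto simp: E_def e_def)
  have degree: "exp (s * real (vertex_degree n (\<lambda>i j. if \<omega> (min i j, max i j) then 1 else 0) i))
      = (\<Prod>a\<in>E. f a (\<omega> a))" for \<omega>
  proof -
    have "exp (s * real (vertex_degree n (\<lambda>i j. if \<omega> (min i j, max i j) then 1 else 0) i))
        = (\<Prod>j=1..n. f (e j) (\<omega> (e j)))"
      unfolding vertex_degree_def of_nat_sum sum_distrib_left
      by (subst exp_sum) (auto simp: f_def e_def intro!: prod.cong)
    also have "\<dots> = (\<Prod>a\<in>e ` {1..n}. f a (\<omega> a))"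
      by (subst prod.reindex[OF inj]) simp
    also have "\<dots> = (\<Prod>a\<in>E. f a (\<omega> a))"
      using fin sub by (intro prod.mono_neutral_left) (auto simp: f_def)
    finally show ?thesis .
  qed
  have "measure_pmf.expectation (adjacency_pmf n p) (\<lambda>A. exp (s * real (vertex_degree n A i)))
      = measure_pmf.expectation (Pi_pmf E False (\<lambda>(i, j). bernoulli_pmf (p i j)))
          (\<lambda>\<omega>. \<Prod>a\<in>E. f a (\<omega> a))"
    unfolding adjacency_pmf_def E_def[symmetric] by (simp add: degree)
  also have "\<dots> = (\<Prod>a\<in>E. measure_pmf.expectation (case a of (i, j) \<Rightarrow> bernoulli_pmf (p i j)) (f a))"
    using fin by (intro expectation_prod_Pi_pmf)
      (auto simp: f_def split: prod.splits intro!: integrable_measure_pmf_finite)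
  also have "\<dots> = (\<Prod>a\<in>e ` {1..n}. measure_pmf.expectation (case a of (i, j) \<Rightarrow> bernoulli_pmf (p i j)) (f a))"
    using fin sub by (intro prod.mono_neutral_right) (auto simp: f_def[abs_def])
  also have "\<dots> = (\<Prod>j=1..n. 1 + p i j * (exp s - 1))"
    unfolding prod.reindex[OF inj]
  proof (rule prod.cong)
    fix j assume j: "j \<in> {1..n}"
    have "p (min i j) (max i j) = p i j" "0 \<le> p i j" "p i j \<le> 1"
      using p i j by (auto simp: edge_probs_def min_def max_def)
    moreover have "f (e j) b = (if b then exp s else 1)" for b using j by (simp add: f_def)
    ultimately show "((\<lambda>a. measure_pmf.expectation (case a of (i, j) \<Rightarrow> bernoulli_pmf (p i j)) (f a)) \<circ> e) j
        = 1 + p i j * (exp s - 1)"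
      by (simp add: e_def algebra_simps)
  qed simp
  also have "\<dots> \<le> (\<Prod>j=1..n. exp (p i j * (exp s - 1)))"
  proof (rule prod_mono)
    fix j assume j: "j \<in> {1..n}"
    have "0 \<le> p i j" "p i j \<le> 1" using p i j by (auto simp: edge_probs_def)
    \<comment> \<open>The factor is a convex combination of 1 and \<open>exp s\<close>, hence
      nonnegative for either sign of \<open>s\<close>.\<close>
    hence "0 \<le> (1 - p i j) + p i j * exp s" by (intro add_nonneg_nonneg) auto
    hence "0 \<le> 1 + p i j * (exp s - 1)" by (simp add: right_diff_distrib)
    thus "0 \<le> 1 + p i j * (exp s - 1) \<and> 1 + p i j * (exp s - 1) \<le> exp (p i j * (exp s - 1))"
      by simp
  qed
  also have "\<dots> = exp (mean_degree n p i * (exp s - 1))"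
    by (simp add: mean_degree_def sum_distrib_right exp_sum)
  finally show ?thesis .
qed

lemma finite_set_adjacency_pmf: "finite (set_pmf (adjacency_pmf n p))"
proof -
  have "finite (set_pmf (Pi_pmf {(i, j). 1 \<le> i \<and> i \<le> j \<and> j \<le> n} False
      (\<lambda>(i, j). bernoulli_pmf (p i j))))"
    using finite_edges by (subst set_Pi_pmf) (rule finite_edges finite_PiE_dflt, auto)
  thus ?thesis by (simp add: adjacency_pmf_def)
qed

text \<open>Markov's inequality for the sum. Degrees of distinct vertices share an edge variable,
  but linearity of expectation reduces the mean to single degrees.\<close>

lemma prob_sum_exp_vertex_degree_ge:
  assumes p: "edge_probs n p" and n: "n \<ge> 1" and s: "0 \<le> s" and c: "0 < c"
  shows "measure_pmf.prob (adjacency_pmf n p)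
      {A. (\<Sum>i=1..n. exp (s * real (vertex_degree n A i))) \<ge> c}
    \<le> real n * exp (max_mean_degree n p * (exp s - 1)) / c"
proof -
  let ?M = "adjacency_pmf n p" and ?d = "max_mean_degree n p"
  have int: "integrable (measure_pmf ?M) h" for h :: "_ \<Rightarrow> real"
    by (rule integrable_measure_pmf_finite[OF finite_set_adjacency_pmf])
  have "measure_pmf.prob ?M {A. (\<Sum>i=1..n. exp (s * real (vertex_degree n A i))) \<ge> c}
      \<le> measure_pmf.expectation ?M (\<lambda>A. \<Sum>i=1..n. exp (s * real (vertex_degree n A i))) / c"
    using integral_Markov_inequality_measure[OF int, of "{}"
        "\<lambda>A. \<Sum>i=1..n. exp (s * real (vertex_degree n A i))" c] c
    by (simp add: sum_nonneg)
  also have "measure_pmf.expectation ?M (\<lambda>A. \<Sum>i=1..n. exp (s * real (vertex_degree n A i)))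
      = (\<Sum>i=1..n. measure_pmf.expectation ?M (\<lambda>A. exp (s * real (vertex_degree n A i))))"
    by (rule Bochner_Integration.integral_sum) (rule int)
  also have "\<dots> \<le> (\<Sum>i=1..n. exp (?d * (exp s - 1)))"
  proof (rule sum_mono)
    fix i assume i: "i \<in> {1..n}"
    have "mean_degree n p i \<le> ?d" using i by (simp add: max_mean_degree_def)
    hence "exp (mean_degree n p i * (exp s - 1)) \<le> exp (?d * (exp s - 1))"
      using s by (simp add: mult_right_mono)
    with expectation_exp_vertex_degree_le[OF p i, of s]
    show "measure_pmf.expectation ?M (\<lambda>A. exp (s * real (vertex_degree n A i)))
        \<le> exp (?d * (exp s - 1))" by (rule order_trans)
  qed
  finally show ?thesis using c by (simp add: divide_right_mono)
qed


text \<open>Once \<eta> is so small that \<open>\<eta> powr \<delta> < c / 2\<close>, the exponent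
  is at most \<open>- c / 2\<close> uniformly in \<eta>, and a null sequence in \<open>n\<close>
  alone dominates.\<close>

lemma tendsto_powr_vanishing_exponent:
  fixes c \<delta> :: real
  assumes "0 < c" "0 < \<delta>"
  shows "((\<lambda>(n, \<eta>). real n powr (\<eta> powr \<delta> - c)) \<longlongrightarrow> 0) (sequentially \<times>\<^sub>F at_right 0)"
proof (rule tendsto_sandwich[OF _ _ tendsto_const])
  have "((\<lambda>\<eta>::real. \<eta> powr \<delta>) \<longlongrightarrow> 0 powr \<delta>) (at_right 0)"
    using assms by (intro tendsto_powr2 tendsto_intros)
      (auto simp: eventually_at_right_less intro!: eventually_mono[OF eventually_at_right_less])
  hence "\<forall>\<^sub>F \<eta>::real in at_right 0. \<eta> powr \<delta> < c / 2"
    using assms by (intro order_tendstoD(2)) auto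
  hence "\<forall>\<^sub>F x::nat \<times> real in sequentially \<times>\<^sub>F at_right 0. 1 \<le> fst x \<and> snd x powr \<delta> < c / 2"
    using eventually_prodI[OF eventually_ge_at_top[of 1]] by fastforce
  thus "\<forall>\<^sub>F x in sequentially \<times>\<^sub>F at_right 0.
      (case x of (n, \<eta>) \<Rightarrow> real n powr (\<eta> powr \<delta> - c)) \<le> real (fst x) powr (- (c / 2))"
    by eventually_elim (auto intro!: powr_mono)
  have "((\<lambda>n. real n powr (- (c / 2))) \<longlongrightarrow> 0) sequentially"
    using assms by (intro tendsto_neg_powr filterlim_real_sequentially) auto
  thus "((\<lambda>x::nat \<times> real. real (fst x) powr (- (c / 2))) \<longlongrightarrow> 0) (sequentially \<times>\<^sub>F at_right 0)"
    by (rule filterlim_compose) (rule filterlim_fst)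
qed (simp add: case_prod_beta)

text \<open>The lower bound is free of \<open>k\<close>, so a violation at any rank falls into one
  and the same event and no union bound over \<open>k\<close> arises.\<close>

lemma sum_exp_vertex_degree_ge:
  fixes d \<epsilon> :: real and n :: nat
  defines "\<delta> \<equiv> \<epsilon> / (2 + \<epsilon>)" and "t \<equiv> ln (ln (real n) / d)"
  assumes \<epsilon>: "0 < \<epsilon>" "\<epsilon> < 1" and t: "0 < t" and n: "1 \<le> n"
    and k: "k \<in> upto_real (real n powr (1 - \<epsilon>))"
    and large: "(1 + \<epsilon>) * L_seq n d k < real (decreasing_degree n A k)"
  shows "real n powr (1 + \<epsilon> * \<delta>) \<le> (\<Sum>i=1..n. exp ((1 - \<delta>) * t * real (vertex_degree n A i)))"
proof -
  have \<delta>: "0 < \<delta>" "\<delta> < 1" using \<epsilon> by (auto simp: \<delta>_def)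
  have k1: "1 \<le> k" using k by (simp add: upto_real_def)
  have "k \<le> nat \<lfloor>real n powr (1 - \<epsilon>)\<rfloor>" using k by (simp add: upto_real_def)
  hence kle: "real k \<le> real n powr (1 - \<epsilon>)" by (simp add: le_nat_floor le_nat_iff le_floor_iff)
  also have "\<dots> \<le> real n powr 1" using \<epsilon> n by (intro powr_mono) auto
  finally have kn: "k \<le> n" using n by simp
  have "real n powr \<epsilon> * real k \<le> real n powr \<epsilon> * real n powr (1 - \<epsilon>)"
    using kle by (intro mult_left_mono) auto
  also have "\<dots> = real n" using n by (simp flip: powr_add)
  finally have ratio: "real n powr \<epsilon> \<le> real n / real k" using k1 by (simp add: field_simps)
  \<comment> \<open>Solving this equation for \<delta> gives the value
    \<open>\<epsilon> / (2 + \<epsilon>)\<close>.\<close>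
  have \<delta>\<epsilon>: "(1 - \<delta>) * (1 + \<epsilon>) = 1 + \<delta>"
    using \<epsilon> by (simp add: \<delta>_def field_simps)
  have "real n powr (1 + \<epsilon> * \<delta>) = real n * (real n powr \<epsilon>) powr \<delta>"
    using n by (simp add: powr_add powr_powr)
  also have "\<dots> \<le> real n * (real n / real k) powr \<delta>"
    using ratio \<delta> by (intro mult_left_mono powr_mono2) auto
  \<comment> \<open>One power of \<open>n / k\<close> absorbs the factor \<open>n\<close> into
    \<open>k\<close>, the number of vertices counted.\<close>
  also have "\<dots> = real k * (real n / real k) powr (1 + \<delta>)"
    using n k1 by (simp add: powr_add)
  also have "\<dots> = real k * exp ((1 - \<delta>) * t * ((1 + \<epsilon>) * L_seq n d k))"
  proof -
    have "(1 - \<delta>) * t * ((1 + \<epsilon>) * L_seq n d k) = ((1 - \<delta>) * (1 + \<epsilon>)) * (t * L_seq n d k)"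
      by (simp only: mult_ac)
    also have "t * L_seq n d k = ln (real n / real k)"
      using t by (simp add: L_seq_def t_def)
    finally show ?thesis using n k1 by (simp add: \<delta>\<epsilon> powr_def)
  qed
  also have "\<dots> \<le> real k * exp ((1 - \<delta>) * t * real (decreasing_degree n A k))"
    using large \<delta> t by (intro mult_left_mono) auto
  also have "\<dots> \<le> (\<Sum>i=1..n. exp ((1 - \<delta>) * t * real (vertex_degree n A i)))"
    using k1 kn \<delta> t by (intro mult_decreasing_degree_le_sum) (auto intro!: monoI mult_left_mono)
  finally show ?thesis .
qed

text \<open>The estimate is stated for every \<eta> in (0, 1), but has content only when
  \<open>\<eta> powr \<delta> < \<epsilon> * \<delta>\<close>; otherwise its left side is at most
  0.\<close>

lemma prob_decreasing_degree_le:
  fixes p :: "nat \<Rightarrow> nat \<Rightarrow> real" and \<epsilon> \<eta> :: real and n :: nat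
  defines "\<delta> \<equiv> \<epsilon> / (2 + \<epsilon>)" and "d \<equiv> max_mean_degree n p"
  assumes \<epsilon>: "0 < \<epsilon>" "\<epsilon> < 1" and n: "1 \<le> n" and \<eta>: "0 < \<eta>" "\<eta> < 1"
    and p: "edge_probs n p" and d: "0 < d" "d \<le> \<eta> * ln (real n)"
  shows "1 - real n powr (\<eta> powr \<delta> - \<epsilon> * \<delta>) \<le> measure_pmf.prob (adjacency_pmf n p)
    {A. \<forall>k\<in>upto_real (real n powr (1 - \<epsilon>)). real (decreasing_degree n A k) \<le> (1 + \<epsilon>) * L_seq n d k}"
    (is "_ \<le> measure_pmf.prob ?M ?E")
proof -
  define l where "l = ln (real n)"
  define t where "t = ln (l / d)"
  have \<delta>: "0 < \<delta>" "\<delta> < 1" using \<epsilon> by (auto simp: \<delta>_def)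
  \<comment> \<open>Positivity of \<open>d\<close> together with
    \<open>d \<le> \<eta> * ln n\<close> excludes \<open>n = 1\<close>.\<close>
  have l: "0 < l" using d \<eta> by (metis l_def less_le_trans zero_less_mult_pos)
  have "d < l" using d(2) mult_strict_right_mono[OF \<eta>(2) l] by (simp add: l_def)
  hence t: "0 < t" using d by (simp add: t_def)
  have "d * exp ((1 - \<delta>) * t) = d * (l / d) powr (1 - \<delta>)"
    using d l by (simp add: powr_def t_def)
  \<comment> \<open>This is the gain from using \<open>(1 - \<delta>) * t\<close> instead of
    \<open>t\<close>: the full exponent would give \<open>d * exp t = l\<close>, without the small
    factor \<open>(d / l) powr \<delta>\<close>.\<close>
  also have "\<dots> = l * (d / l) powr \<delta>"
    using d l by (simp add: powr_diff powr_divide field_simps)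
  also have "\<dots> \<le> l * \<eta> powr \<delta>"
    using d l \<delta> by (intro mult_left_mono powr_mono2) (auto simp: l_def field_simps)
  finally have mgf: "d * exp ((1 - \<delta>) * t) \<le> l * \<eta> powr \<delta>" .
  have "1 - measure_pmf.prob ?M ?E = measure_pmf.prob ?M (- ?E)"
    using measure_pmf.prob_compl[of ?E ?M] by (simp add: Compl_eq_Diff_UNIV)
  also have "\<dots> \<le> measure_pmf.prob ?M {A. real n powr (1 + \<epsilon> * \<delta>)
      \<le> (\<Sum>i=1..n. exp ((1 - \<delta>) * t * real (vertex_degree n A i)))}"
    using sum_exp_vertex_degree_ge[OF \<epsilon> _ n, where d = d] t
    by (intro measure_pmf.finite_measure_mono) (auto simp: \<delta>_def t_def l_def not_le)
  also have "\<dots> \<le> real n * exp (d * (exp ((1 - \<delta>) * t) - 1)) / real n powr (1 + \<epsilon> * \<delta>)"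
    unfolding d_def using \<delta> t n by (intro prob_sum_exp_vertex_degree_ge[OF p n]) auto
  \<comment> \<open>The term \<open>- d\<close> in the exponent is negative and is dropped.\<close>
  also have "\<dots> \<le> real n * exp (l * \<eta> powr \<delta>) / real n powr (1 + \<epsilon> * \<delta>)"
    using mgf d by (intro divide_right_mono mult_left_mono) (auto simp: algebra_simps)
  also have "\<dots> = real n powr (\<eta> powr \<delta> - \<epsilon> * \<delta>)"
    using n by (simp add: l_def powr_def exp_add exp_diff algebra_simps)
  finally show ?thesis by simp
qed

theorem proposition1p11:
  fixes \<epsilon> :: real
  assumes "0 < \<epsilon>" and "\<epsilon> < 1"
  shows "holds_whp_under
    (\<lambda>n \<kappa> \<eta> p. \<kappa> \<le> max_mean_degree n p \<and> max_mean_degree n p \<le> \<eta> * ln (real n) \<and>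
       p_max n p \<le> real n powr (- 1 + \<eta>))
    (\<lambda>n p. {A. \<forall>k\<in>upto_real (real n powr (1 - \<epsilon>)).
       real (decreasing_degree n A k) \<le> (1 + \<epsilon>) * L_seq n (max_mean_degree n p) k})"
proof -
  define \<delta> where "\<delta> = \<epsilon> / (2 + \<epsilon>)"
  have "0 < \<delta>" using assms by (simp add: \<delta>_def)
  \<comment> \<open>The error function is the same for all \<kappa>; in the bound below,
    \<open>0 < \<kappa>\<close> and \<kappa> \<le> d supply the positivity of the maximal mean
    degree.\<close>
  hence "admissible_error (\<lambda>n \<kappa> \<eta>. real n powr (\<eta> powr \<delta> - \<epsilon> * \<delta>))"
    unfolding admissible_error_def using assms by (auto intro: tendsto_powr_vanishing_exponent)
  thus ?thesis
    unfolding holds_whp_under_def using prob_decreasing_degree_le[OF assms]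
    by (intro exI[of _ "\<lambda>n \<kappa> \<eta>. real n powr (\<eta> powr \<delta> - \<epsilon> * \<delta>)"]) (auto simp: \<delta>_def)
qed

end
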